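(* For every starting value $n\in\mathbb N$ and every integer $G\ge2$, some iterate $x=T^t(n)$ ($t\ge0$) satisfies $$x\le n+P_{(G+1)\left\lceil\frac{\log(G+1)}{\log2}\right\rceil}+G+1\qquad\text{and}\qquad \tau(x)>G.$$ In particular, for some absolute constant $C>0$ (independent of $n$ and $G$), such an $x$ satisfies $$x\le n+\exp\bigl(CG\log G\log(G\log G)\bigr),$$ and more sharply, as $G\to\infty$, $$\log P_{(G+1)\left\lceil\frac{\log(G+1)}{\log2}\right\rceil}=\left(\frac1{\log2}+o(1)\right)G\log G\log(G\log G).$$ Consequently, for every fixed starting value $n$, $$\max_{\substack{t\ge0\\ T^t(n)\le n+Y}}\tau(T^t(n))\ge(\log2-o(1))\frac{\log Y}{(\log\log Y)^2}\qquad(Y\to\infty),$$ and in particular $\limsup_{t\to\infty}\tau(T^t(n))=\infty$.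
   Context: $\mathbb N=\{1,2,3,\dots\}$; $\tau(n)$ is the number of positive divisors of $n$; $T(n)=n+\tau(n)$, and $T^t$ is the $t$-th iterate. $p_1<p_2<\cdots$ are the primes in increasing order and $P_K=\prod_{u\le K}p_u$ is the product of the first $K$ primes. $\log$ is the natural logarithm. *)

theory Defs
  imports
    "HOL-Computational_Algebra.Primes"
    "HOL-Library.Infinite_Set"
    "HOL-Library.Extended_Real"
    "HOL-Library.Liminf_Limsup"
    Complex_Main
begin

(* Only used for n >= 1: the set of divisors of 0 is infinite, so divisor_tau 0 = 0. *)
definition divisor_tau :: "nat \<Rightarrow> nat" where
  "divisor_tau n = card {d. d dvd n}"

definition tau_step :: "nat \<Rightarrow> nat" where
  "tau_step n = n + divisor_tau n"

(* The enumeration starts at index 0, so this is the product of the first K primes. *)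
definition primorial :: "nat \<Rightarrow> nat" where
  "primorial K = (\<Prod>u<K. enumerate {p::nat. prime p} u)"

definition prime_budget :: "nat \<Rightarrow> nat" where
  "prime_budget G = (G + 1) * nat \<lceil>ln (real (G + 1)) / ln 2\<rceil>"

end

theory Submission
  imports
    Defs
    "HOL-Number_Theory.Cong"
    "HOL-Real_Asymp.Real_Asymp"
begin

text \<open>
  Write \<open>\<tau>\<close> for the divisor function and \<open>T n = n + \<tau> n\<close>. An orbit of \<open>T\<close> on which \<open>\<tau>\<close> never
  exceeds \<open>G\<close> moves in steps of length at most \<open>G\<close>, so it cannot jump over a window of \<open>G + 1\<close>
  consecutive integers. If every member of the window has more than \<open>G\<close> divisors, then hitting
  the window yields a large value of \<open>\<tau>\<close>; and jumping over it is only possible from a point that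
  already has more than \<open>G\<close> divisors (\<open>orbit_meets_window\<close>). Such a window is built with the Chinese
  remainder theorem: cut the first \<open>(G + 1) * c\<close> primes, with \<open>2 ^ c \<ge> G + 1\<close>, into \<open>G + 1\<close> blocks
  of \<open>c\<close> primes, and make the \<open>i\<close>-th integer of the window divisible by all primes of the \<open>i\<close>-th
  block. The period of the congruences is the primorial, which bounds how far above \<open>n\<close> the window
  starts (\<open>window_with_many_divisors\<close>). Restarting the argument anywhere on the orbit gives
  \<open>limsup = \<infinity>\<close>.

  The quantitative claims reduce to \<open>ln P\<^sub>K \<sim> K ln K\<close> for the product \<open>P\<^sub>K\<close> of the first \<open>K\<close>
  primes. Since \<open>K! \<le> P\<^sub>K \<le> p ^ K\<close> for the first prime \<open>p\<close> beyond those in the product, it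
  suffices that \<open>ln p \<sim> ln K\<close>, which tolerates factors \<open>K ^ o(1)\<close> in \<open>p\<close>. It follows from Chebyshev's bound \<open>2 ^ (n - 1) \<le> n ^ \<pi>(n)\<close>, which comes
  from bounding a common multiple of \<open>1, ..., n\<close> in two ways: from above it can be taken as a product
  of \<open>\<pi>(n)\<close> prime powers not exceeding \<open>n\<close>, from below it is divisible by every \<open>k * (n choose k)\<close>,
  and these numbers average \<open>2 ^ (n - 1)\<close>.

  Substituting the number of primes, which is \<open>G ln G / ln 2\<close> up to a factor \<open>1 + o(1)\<close>, gives the
  asymptotic formula in \<open>G\<close>. For the bound in terms of \<open>Y\<close> the formula is inverted by hand: with
  \<open>L = ln Y\<close> and \<open>\<delta> > 0\<close>, the value \<open>G = \<lfloor>(ln 2 - \<delta>) L / (ln L)\<^sup>2\<rfloor>\<close> is small enough for the window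
  to lie within distance \<open>Y\<close> of \<open>n\<close>, eventually.
\<close>

section \<open>The divisor function along an orbit\<close>

lemma divisor_tau_pos:
  assumes "n \<ge> 1"
  shows "divisor_tau n \<ge> 1"
proof -
  have "card {1::nat} \<le> card {d. d dvd n}"
    using assms by (intro card_mono) auto
  then show ?thesis by (simp add: divisor_tau_def)
qed

lemma tau_step_iterate_ge:
  assumes "n \<ge> 1"
  shows "(tau_step ^^ t) n \<ge> n + t"
proof (induction t)
  case (Suc t)
  have "divisor_tau ((tau_step ^^ t) n) \<ge> 1"
    using Suc assms by (intro divisor_tau_pos) linarith
  moreover have "(tau_step ^^ Suc t) n = (tau_step ^^ t) n + divisor_tau ((tau_step ^^ t) n)"
    by (simp only: funpow.simps o_apply tau_step_def)
  ultimately show ?case using Suc by linarith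
qed simp

text \<open>Distinct subsets of a set of primes dividing \<open>x\<close> have distinct products, by unique
  factorization, and each of these products is a divisor of \<open>x\<close>.\<close>

lemma two_power_card_le_divisor_tau:
  assumes A: "finite A" "\<And>p. p \<in> A \<Longrightarrow> prime p" and x: "\<Prod>A dvd x" "x > 0"
  shows "2 ^ card A \<le> divisor_tau x"
proof -
  have factors: "prime_factors (\<Prod>S) = S" if "S \<subseteq> A" for S
  proof -
    have "finite S" and pr: "\<And>p. p \<in> S \<Longrightarrow> prime p"
      using that A finite_subset by auto
    then have "prime_factors (prod id S) = (\<Union>p\<in>S. prime_factors p)"
      by (subst prime_factors_prod) force+
    also have "\<dots> = S"
      using pr by (auto simp: prime_factorization_prime)
    finally show ?thesis by simp
  qed
  then have "inj_on Prod (Pow A)"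
    by (metis PowD inj_onI)
  moreover have "Prod ` Pow A \<subseteq> {d. d dvd x}"
  proof clarify
    fix S assume "S \<subseteq> A"
    then have "\<Prod>S dvd \<Prod>A" using A(1) by (intro prod_dvd_prod_subset)
    then show "\<Prod>S dvd x" using x(1) dvd_trans by blast
  qed
  moreover have "finite {d. d dvd x}" using x by simp
  ultimately have "card (Pow A) \<le> card {d. d dvd x}"
    by (rule card_inj_on_le)
  then show ?thesis using A by (simp add: divisor_tau_def card_Pow)
qed

text \<open>Consider the first iterate that is at least \<open>N\<close>, and its predecessor \<open>y < N\<close>. Either \<open>y\<close> itself
  has more than \<open>G\<close> divisors, or the step from \<open>y\<close> has length at most \<open>G\<close> and so lands in the window.\<close>

lemma orbit_meets_window:
  assumes "n \<ge> 1" and "n \<le> N"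
    and window: "\<And>y. N \<le> y \<Longrightarrow> y \<le> N + G \<Longrightarrow> divisor_tau y > G"
  shows "\<exists>t. (tau_step ^^ t) n \<le> N + G \<and> divisor_tau ((tau_step ^^ t) n) > G"
proof -
  define t where "t = (LEAST t. (tau_step ^^ t) n \<ge> N)"
  have "(tau_step ^^ N) n \<ge> N"
    using tau_step_iterate_ge[OF assms(1), of N] by linarith
  then have t: "(tau_step ^^ t) n \<ge> N" and least: "\<And>s. s < t \<Longrightarrow> (tau_step ^^ s) n < N"
    unfolding t_def by (auto intro: LeastI dest: not_less_Least simp: not_le)
  show ?thesis
  proof (cases t)
    case 0
    then show ?thesis using t assms(2) window[of n] by (intro exI[of _ 0]) auto
  next
    case (Suc s)
    define y where "y = (tau_step ^^ s) n"
    have y: "y < N" using least[of s] Suc by (simp add: y_def)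
    show ?thesis
    proof (cases "divisor_tau y > G")
      case True
      then show ?thesis using y unfolding y_def by (intro exI[of _ s]) auto
    next
      case False
      have "(tau_step ^^ t) n = y + divisor_tau y" by (simp add: Suc y_def tau_step_def)
      then show ?thesis using False y t window by (intro exI[of _ t]) auto
    qed
  qed
qed

section \<open>A window of integers with many divisors\<close>

abbreviation nth_prime :: "nat \<Rightarrow> nat" where
  "nth_prime \<equiv> enumerate {p. prime p}"

lemma prime_nth_prime: "prime (nth_prime u)"
  using enumerate_in_set[OF primes_infinite, of u] by simp

lemma inj_nth_prime: "inj nth_prime"
  by (rule inj_enumerate[OF primes_infinite])

lemma nth_prime_ge: "nth_prime u \<ge> u + 1"
proof (induction u)
  case 0
  then show ?case using prime_ge_2_nat[OF prime_nth_prime, of 0] by simp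
next
  case (Suc u)
  then show ?case using enumerate_step[OF primes_infinite, of u] by linarith
qed

text \<open>The unknown of the congruences is the offset \<open>x = N - n\<close>, for which the Chinese remainder
  theorem supplies a solution below the product of the moduli: this places \<open>N\<close> within one period
  above \<open>n\<close>.\<close>

lemma window_with_many_divisors:
  assumes "n \<ge> 1"
  shows "\<exists>N\<ge>n. N < n + primorial (w * c) \<and>
    (\<forall>i<w. 2 ^ c \<le> divisor_tau (N + i))"
proof -
  define B where "B i = nth_prime ` {i * c..<i * c + c}" for i
  define m where "m i = \<Prod>(B i)" for i
  have prime_B: "prime p" if "p \<in> B i" for p i
    using that by (auto simp: B_def prime_nth_prime)
  have fin_B: "finite (B i)" for i by (simp add: B_def)
  have card_B: "card (B i) = c" for i
    using inj_nth_prime by (simp add: B_def card_image inj_on_subset)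
  have m_eq: "m i = prod nth_prime {i * c..<i * c + c}" for i
    unfolding m_def B_def
    using inj_on_subset[OF inj_nth_prime subset_UNIV] by (subst prod.reindex) auto
  have m_pos: "m i > 0" for i
    unfolding m_eq by (intro prod_pos) (simp add: prime_gt_0_nat prime_nth_prime)
  have prod_m: "(\<Prod>i<w. m i) = primorial (w * c)"
    unfolding m_eq primorial_def by (rule prod.nat_group)
  have cop: "coprime (m i) (m j)" if "i \<noteq> j" for i j
  proof -
    have disj: "{i * c..<i * c + c} \<inter> {j * c..<j * c + c} = {}"
    proof -
      have "u div c = k" if "u \<in> {k * c..<k * c + c}" for u k
        using that by (intro div_nat_eqI) (auto simp: algebra_simps)
      then show ?thesis using that by blast
    qed
    show ?thesis unfolding m_eq
    proof (intro prod_coprime_left prod_coprime_right)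
      fix u v assume "u \<in> {i * c..<i * c + c}" "v \<in> {j * c..<j * c + c}"
      then have "u \<noteq> v" using disj by blast
      then have "nth_prime u \<noteq> nth_prime v" using inj_nth_prime by (simp add: inj_eq)
      then show "coprime (nth_prime u) (nth_prime v)"
        by (simp add: primes_coprime prime_nth_prime)
    qed
  qed
  \<comment> \<open>The residue \<open>(m i - 1) * (n + i)\<close> is a representative of \<open>- (n + i)\<close> that avoids
    subtraction from \<open>0\<close>.\<close>
  obtain x where x: "x < (\<Prod>i<w. m i)" "\<forall>i\<in>{..<w}. [x = (m i - 1) * (n + i)] (mod m i)"
    using chinese_remainder_unique_nat[of "{..<w}" m "\<lambda>i. (m i - 1) * (n + i)"] m_pos cop
    by (metis finite_lessThan less_numeral_extra(3))
  have "2 ^ c \<le> divisor_tau (n + x + i)" if "i < w" for i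
  proof -
    have "[x + (n + i) = (m i - 1) * (n + i) + (n + i)] (mod m i)"
      using x(2) that by (intro cong_add) auto
    also have "(m i - 1) * (n + i) + (n + i) = m i * (n + i)"
      using m_pos[of i] by (cases "m i") auto
    finally have "[x + (n + i) = m i * (n + i)] (mod m i)" .
    then have "m i dvd x + (n + i)" using cong_dvd_iff dvd_triv_left by blast
    then have "\<Prod>(B i) dvd n + x + i" by (simp add: m_def ac_simps)
    then show ?thesis
      using two_power_card_le_divisor_tau[of "B i" "n + x + i"] fin_B prime_B card_B assms by simp
  qed
  then show ?thesis using x(1) prod_m by (intro exI[of _ "n + x"]) auto
qed

lemma le_two_power_ceiling_log:
  "G + 1 \<le> 2 ^ nat \<lceil>ln (real (G + 1)) / ln 2\<rceil>"
proof -
  have "ln (real (G + 1)) / ln 2 \<le> real (nat \<lceil>ln (real (G + 1)) / ln 2\<rceil>)"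
    by linarith
  then have "ln (real (G + 1)) \<le> real (nat \<lceil>ln (real (G + 1)) / ln 2\<rceil>) * ln 2"
    by (subst (asm) pos_divide_le_eq) auto
  also have "\<dots> = ln (2 ^ nat \<lceil>ln (real (G + 1)) / ln 2\<rceil>)"
    by (simp add: ln_realpow)
  finally have "real (G + 1) \<le> 2 ^ nat \<lceil>ln (real (G + 1)) / ln 2\<rceil>"
    by (subst (asm) ln_le_cancel_iff) auto
  then show ?thesis by (metis of_nat_le_iff of_nat_numeral of_nat_power)
qed

lemma large_divisor_count_on_orbit:
  assumes "n \<ge> 1"
  shows "\<exists>t. (tau_step ^^ t) n \<le> n + primorial (prime_budget G) + G + 1 \<and>
    divisor_tau ((tau_step ^^ t) n) > G"
proof -
  define c where "c = nat \<lceil>ln (real (G + 1)) / ln 2\<rceil>"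
  have K: "prime_budget G = (G + 1) * c" by (simp only: prime_budget_def c_def)
  obtain N where N: "n \<le> N" "N < n + primorial (prime_budget G)"
    and w: "\<And>i. i < G + 1 \<Longrightarrow> 2 ^ c \<le> divisor_tau (N + i)"
    using window_with_many_divisors[OF assms, of "G + 1" c] unfolding K by blast
  have "divisor_tau y > G" if y: "N \<le> y" "y \<le> N + G" for y
  proof -
    have "2 ^ c \<le> divisor_tau y" using w[of "y - N"] y by simp
    moreover have "G + 1 \<le> 2 ^ c" unfolding c_def by (rule le_two_power_ceiling_log)
    ultimately show ?thesis by linarith
  qed
  then obtain t where "(tau_step ^^ t) n \<le> N + G" "divisor_tau ((tau_step ^^ t) n) > G"
    using orbit_meets_window[OF assms N(1), of G] by blast
  then show ?thesis using N(2) by (intro exI[of _ t]) auto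
qed

section \<open>Chebyshev's lower bound for the number of primes\<close>

text \<open>The reciprocals of the numbers \<open>k * (n choose k)\<close> form Leibniz's harmonic triangle. Its rule that
  each entry is a difference of two entries of the previous column,
  \<open>1 / ((k + 1) * (n + 1 choose k + 1)) = 1 / (k * (n choose k)) - 1 / (k * (n + 1 choose k))\<close>,
  shows that \<open>D\<close> times an entry is an integer once this holds for the entries \<open>1 / n\<close> of the first
  column. The proof clears denominators: with \<open>a\<close>, \<open>b\<close>, \<open>c\<close> for the three numbers involved, the rule
  reads \<open>c * (b - a) = a * b\<close>.\<close>

lemma mult_binomial_dvd_common_multiple:
  assumes "\<And>m. 1 \<le> m \<Longrightarrow> m \<le> n \<Longrightarrow> m dvd D" and "1 \<le> k" and "k \<le> n"
  shows "k * (n choose k) dvd D"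
  using assms(2,3,1)
proof (induction k arbitrary: n rule: nat_induct_at_least)
  case base
  then show ?case by simp
next
  case (Suc k)
  obtain n' where n: "n = Suc n'" using Suc by (cases n) auto
  define a where "a = int (k * (n' choose k))"
  define b where "b = int (k * (n choose k))"
  define c where "c = int (Suc k * (n choose Suc k))"
  have pos: "a > 0" "b > 0" using Suc.hyps Suc.prems n by (simp_all add: a_def b_def)
  have "k * (n' choose k) dvd D" "k * (n choose k) dvd D"
    using Suc.IH[of n'] Suc.IH[of n] Suc.prems n by simp_all
  then have "a dvd int D" "b dvd int D" unfolding a_def b_def int_dvd_int_iff .
  then obtain x y where x: "int D = a * x" and y: "int D = b * y" by (auto elim!: dvdE)
  have cba: "c * (b - a) = a * b"
  proof -
    obtain l where k: "k = Suc l" using Suc.hyps by (cases k) auto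
    have c: "c = int n * int (n' choose k)"
      unfolding c_def n by (simp only: Suc_times_binomial of_nat_mult)
    have b: "b = int n * int (n' choose l)"
      unfolding b_def n k by (simp only: Suc_times_binomial of_nat_mult)
    have "b - a = int k * int (n' choose l)"
      unfolding b_def a_def n k by (simp add: algebra_simps)
    then have "c * (b - a) = (int n * int (n' choose k)) * (int k * int (n' choose l))"
      by (simp only: c)
    then show ?thesis by (simp add: a_def b)
  qed
  have "(a * b) * (c * (x - y)) = (c * b) * (a * x) - (c * a) * (b * y)"
    by (simp add: algebra_simps)
  also have "\<dots> = (c * b) * int D - (c * a) * int D" by (simp only: x[symmetric] y[symmetric])
  also have "\<dots> = c * (b - a) * int D" by (simp add: algebra_simps)
  also have "\<dots> = (a * b) * int D" by (simp add: cba)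
  finally have "c * (x - y) = int D" using pos by simp
  then have "c dvd int D" by (metis dvd_triv_left)
  then show ?case unfolding c_def by (simp only: int_dvd_int_iff)
qed

text \<open>The \<open>n\<close> numbers \<open>k * (n choose k)\<close> for \<open>1 \<le> k \<le> n\<close> sum to \<open>n * 2 ^ (n - 1)\<close>, and \<open>D\<close> is at
  least as large as each of them.\<close>

lemma common_multiple_ge_two_power:
  assumes "n \<ge> 1" and "D > 0" and "\<And>m. 1 \<le> m \<Longrightarrow> m \<le> n \<Longrightarrow> m dvd D"
  shows "2 ^ (n - 1) \<le> D"
proof -
  have "n * 2 ^ (n - 1) = (\<Sum>k\<le>n. k * (n choose k))"
    by (simp add: choose_linear_sum)
  also have "\<dots> = (\<Sum>k\<in>{1..n}. k * (n choose k))"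
    by (intro sum.mono_neutral_right) auto
  also have "\<dots> \<le> (\<Sum>k\<in>{1..n}. D)"
    using mult_binomial_dvd_common_multiple[OF assms(3)] assms(2)
    by (intro sum_mono dvd_imp_le) auto
  finally show ?thesis using assms(1) by simp
qed

text \<open>Chebyshev's bound. The common multiple \<open>D\<close> is the least one: its exponent at \<open>p\<close> is attained by
  some \<open>m \<le> n\<close>, so each of its \<open>\<pi>(n)\<close> prime powers is at most \<open>n\<close>.\<close>

lemma two_power_le_power_card_primes:
  assumes "n \<ge> 1"
  shows "2 ^ (n - 1) \<le> n ^ card {p. prime p \<and> p \<le> n}"
proof -
  define P where "P = {p. prime p \<and> p \<le> n}"
  define e where "e p = Max (multiplicity p ` {1..n})" for p
  define D where "D = (\<Prod>p\<in>P. p ^ e p)"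
  have fin: "finite P" by (simp add: P_def)
  have D_le: "D \<le> n ^ card P"
    unfolding D_def
  proof (intro prod_le_power)
    fix p assume "p \<in> P"
    have "e p \<in> multiplicity p ` {1..n}"
      unfolding e_def using assms by (intro Max_in) auto
    then obtain m where m: "1 \<le> m" "m \<le> n" "e p = multiplicity p m" by auto
    then have "p ^ e p dvd m" by (simp add: multiplicity_dvd)
    then have "p ^ e p \<le> m" using m by (intro dvd_imp_le) auto
    then show "0 \<le> p ^ e p \<and> p ^ e p \<le> n" using m by simp
  qed (use assms in auto)
  have "D > 0"
    unfolding D_def by (intro prod_pos) (auto simp: P_def prime_gt_0_nat)
  moreover have "m dvd D" if m: "1 \<le> m" "m \<le> n" for m
  proof -
    have "m = (\<Prod>p\<in>prime_factors m. p ^ multiplicity p m)"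
      using prod_prime_factors[of m] m by simp
    also have "\<dots> dvd D"
      unfolding D_def
    proof (intro prod_dvd_prod_subset2 fin le_imp_power_dvd)
      show "prime_factors m \<subseteq> P"
        using m by (auto simp: P_def prime_factors_dvd dest: dvd_imp_le)
      show "multiplicity p m \<le> e p" for p
        unfolding e_def using m by (intro Max_ge) auto
    qed
    finally show ?thesis .
  qed
  ultimately have "2 ^ (n - 1) \<le> D"
    using common_multiple_ge_two_power assms by blast
  then show ?thesis using D_le unfolding P_def by linarith
qed

text \<open>With indices starting at \<open>0\<close>, at most \<open>K\<close> primes lie below \<open>q = nth_prime K\<close>; so Chebyshev's
  bound at \<open>n = q - 1\<close> gives \<open>2 ^ (q - 2) \<le> q ^ K\<close>.\<close>

lemma nth_prime_chebyshev: "(real (nth_prime K) - 2) * ln 2 \<le> real K * ln (real (nth_prime K))"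
proof -
  let ?q = "nth_prime K"
  have q: "?q \<ge> 2" using prime_ge_2_nat prime_nth_prime by blast
  have "{p. prime p \<and> p \<le> ?q - 1} \<subseteq> nth_prime ` {..<K}"
  proof
    fix p assume "p \<in> {p. prime p \<and> p \<le> ?q - 1}"
    then have p: "prime p" "p < ?q" using q by auto
    obtain u where u: "p = nth_prime u"
      using enumerate_Ex[OF primes_infinite, of p] p by auto
    with p have "u < K" using enumerate_mono_iff[OF primes_infinite, of u K] by simp
    then show "p \<in> nth_prime ` {..<K}" using u by blast
  qed
  then have "card {p. prime p \<and> p \<le> ?q - 1} \<le> card (nth_prime ` {..<K})"
    by (intro card_mono) auto
  also have "\<dots> \<le> K" using card_image_le[of "{..<K}" nth_prime] by simp
  finally have card: "card {p. prime p \<and> p \<le> ?q - 1} \<le> K" .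
  have "2 ^ (?q - 1 - 1) \<le> (?q - 1) ^ card {p. prime p \<and> p \<le> ?q - 1}"
    using q by (intro two_power_le_power_card_primes) simp
  also have "\<dots> \<le> (?q - 1) ^ K" using card q by (intro power_increasing) auto
  also have "\<dots> \<le> ?q ^ K" by (intro power_mono) auto
  finally have "2 ^ (?q - 2) \<le> ?q ^ K" by (simp add: numeral_2_eq_2)
  then have "real (2 ^ (?q - 2)) \<le> real (?q ^ K)" by (simp only: of_nat_le_iff)
  then have "ln (2 ^ (?q - 2) :: real) \<le> ln (real ?q ^ K)"
    using q by (subst ln_le_cancel_iff) auto
  then show ?thesis using q by (simp add: ln_realpow of_nat_diff)
qed

section \<open>The size of the primorial\<close>

text \<open>Taking logarithms once more in \<open>(q - 2) * ln 2 \<le> K * ln q\<close> gives \<open>ln K \<ge> ln q - ln (ln q) - O(1)\<close>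
  for \<open>q = nth_prime K\<close>, while \<open>K < q\<close> gives \<open>ln K \<le> ln q\<close>.\<close>

lemma ln_nth_prime_asymp_equiv: "(\<lambda>K. ln (real (nth_prime K))) \<sim>[at_top] (\<lambda>K. ln (real K))"
proof -
  define r :: "real \<Rightarrow> real" where "r x = (ln (x - 2) + ln (ln 2) - ln (ln x)) / ln x" for x
  have q_lim: "filterlim (\<lambda>K. real (nth_prime K)) at_top at_top"
    using nth_prime_ge
    by (intro filterlim_at_top_mono[OF filterlim_real_sequentially] always_eventually)
       (metis add_leD1 of_nat_le_iff)
  have "(r \<longlongrightarrow> 1) at_top" unfolding r_def by real_asymp
  then have r_lim: "((\<lambda>K. r (real (nth_prime K))) \<longlongrightarrow> 1) at_top"
    by (rule filterlim_compose) (rule q_lim)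
  have "((\<lambda>K. ln (real K) / ln (real (nth_prime K))) \<longlongrightarrow> 1) at_top"
  proof (rule tendsto_sandwich[OF _ _ r_lim tendsto_const])
    have "\<forall>\<^sub>F K in at_top. K > 0 \<and> real (nth_prime K) > 3"
      by (intro eventually_conj eventually_gt_at_top filterlim_at_top_dense[THEN iffD1, OF q_lim, THEN spec])
    then show "\<forall>\<^sub>F K in at_top. r (real (nth_prime K)) \<le> ln (real K) / ln (real (nth_prime K))"
    proof eventually_elim
      case (elim K)
      let ?q = "real (nth_prime K)"
      have "ln ((?q - 2) * ln 2) \<le> ln (real K * ln ?q)"
        using elim nth_prime_chebyshev[of K] by (subst ln_le_cancel_iff) auto
      then have "ln (?q - 2) + ln (ln 2) \<le> ln (real K) + ln (ln ?q)"
        using elim by (simp add: ln_mult)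
      then show ?case using elim unfolding r_def by (intro divide_right_mono) auto
    qed
    show "\<forall>\<^sub>F K in at_top. ln (real K) / ln (real (nth_prime K)) \<le> 1"
      using eventually_gt_at_top[of 0]
    proof eventually_elim
      case (elim K)
      have "real K + 1 \<le> real (nth_prime K)" using nth_prime_ge[of K] by linarith
      then show ?case using elim by (simp add: divide_le_eq_1)
    qed
  qed
  then show ?thesis by (rule asymp_equiv_symI[OF asymp_equivI'])
qed

lemma primorial_pos: "primorial K > 0"
  unfolding primorial_def by (intro prod_pos) (simp add: prime_gt_0_nat prime_nth_prime)

lemma primorial_ge_fact: "fact K \<le> primorial K"
proof (induction K)
  case (Suc K)
  have "(K + 1) * fact K \<le> nth_prime K * primorial K"
    using Suc nth_prime_ge[of K] by (intro mult_mono) auto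
  then show ?case by (simp add: primorial_def lessThan_Suc)
qed (simp add: primorial_def)

lemma primorial_le_power: "primorial K \<le> nth_prime K ^ K"
proof -
  have "prod nth_prime {..<K} \<le> nth_prime K ^ card {..<K}"
    using enumerate_mono_iff[OF primes_infinite]
    by (intro prod_le_power) (auto simp: less_imp_le prime_gt_0_nat prime_nth_prime Suc_le_eq)
  then show ?thesis by (simp add: primorial_def)
qed

text \<open>A single term of the exponential series gives \<open>K ^ K / K! \<le> exp K\<close>.\<close>

lemma ln_fact_ge: "real K * ln (real K) - real K \<le> ln (fact K)"
proof (cases "K = 0")
  case False
  have "(\<lambda>n. real K ^ n /\<^sub>R fact n) sums exp (real K)" by (rule exp_converges)
  then have "real K ^ K /\<^sub>R fact K \<le> exp (real K)"
    using sum_le_suminf[of "\<lambda>n. real K ^ n /\<^sub>R fact n" "{K}"]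
    by (simp add: sums_iff)
  then have "real K ^ K \<le> exp (real K) * fact K" by (simp add: field_simps)
  then have "ln (real K ^ K) \<le> ln (exp (real K) * fact K)"
    using False by (subst ln_le_cancel_iff) auto
  then show ?thesis using False by (simp add: ln_mult ln_realpow)
qed simp

lemma ln_primorial_asymp_equiv: "(\<lambda>K. ln (real (primorial K))) \<sim>[at_top] (\<lambda>K. real K * ln (real K))"
proof (rule asymp_equiv_sandwich_real)
  show "(\<lambda>K. real K * ln (real K) - real K) \<sim>[at_top] (\<lambda>K. real K * ln (real K))"
    by real_asymp
  show "(\<lambda>K. real K * ln (real (nth_prime K))) \<sim>[at_top] (\<lambda>K. real K * ln (real K))"
    by (intro asymp_equiv_mult asymp_equiv_refl ln_nth_prime_asymp_equiv)
  have "ln (real (primorial K)) \<in> {real K * ln (real K) - real K..real K * ln (real (nth_prime K))}" for K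
  proof -
    have "real (fact K) \<le> real (primorial K)"
      using primorial_ge_fact by (simp only: of_nat_le_iff)
    then have "ln (fact K) \<le> ln (real (primorial K))"
      using primorial_pos[of K] by (subst ln_le_cancel_iff) auto
    moreover have "real (primorial K) \<le> real (nth_prime K ^ K)"
      using primorial_le_power by (simp only: of_nat_le_iff)
    then have "ln (real (primorial K)) \<le> ln (real (nth_prime K) ^ K)"
      using primorial_pos[of K] prime_gt_0_nat[OF prime_nth_prime, of K]
      by (subst ln_le_cancel_iff) auto
    moreover have "ln (real (nth_prime K) ^ K) = real K * ln (real (nth_prime K))"
      using prime_gt_0_nat[OF prime_nth_prime, of K] by (simp add: ln_realpow)
    ultimately show ?thesis using ln_fact_ge[of K] by auto
  qed
  then show "\<forall>\<^sub>F K in at_top. ln (real (primorial K))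
      \<in> {real K * ln (real K) - real K..real K * ln (real (nth_prime K))}"
    by simp
qed

abbreviation main_term :: "nat \<Rightarrow> real" where
  "main_term G \<equiv> real G * ln (real G) * ln (real G * ln (real G))"

text \<open>Dropping the ceiling changes the number of primes by at most \<open>G + 1\<close>, which is of smaller order
  than \<open>G * ln G\<close>; hence it can be sandwiched between \<open>l\<close> and \<open>h\<close>, and \<open>x * ln x\<close> is monotone
  for \<open>x \<ge> 1\<close>.\<close>

lemma ln_primorial_prime_budget_asymp_equiv:
  "(\<lambda>G. ln (real (primorial (prime_budget G)))) \<sim>[at_top] (\<lambda>G. 1 / ln 2 * main_term G)"
proof -
  define c where "c = ln (2::real)"
  have c_pos: "c > 0" by (simp add: c_def)
  define l where "l G = (real G + 1) * (ln (real G + 1) / ln 2)" for G :: nat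
  define h where "h G = (real G + 1) * (ln (real G + 1) / ln 2 + 1)" for G :: nat
  have K_bounds: "l G \<le> real (prime_budget G)" "real (prime_budget G) \<le> h G" for G
  proof -
    let ?x = "ln (real G + 1) / ln 2"
    have "0 \<le> ?x" by simp
    then have "?x \<le> real (nat \<lceil>?x\<rceil>)" "real (nat \<lceil>?x\<rceil>) \<le> ?x + 1" by linarith+
    then have "(real G + 1) * ?x \<le> (real G + 1) * real (nat \<lceil>?x\<rceil>)"
      "(real G + 1) * real (nat \<lceil>?x\<rceil>) \<le> (real G + 1) * (?x + 1)"
      by (intro mult_left_mono; simp)+
    moreover have "real (prime_budget G) = (real G + 1) * real (nat \<lceil>?x\<rceil>)"
      by (simp add: prime_budget_def add.commute algebra_simps)
    ultimately show "l G \<le> real (prime_budget G)" "real (prime_budget G) \<le> h G"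
      by (simp_all only: l_def h_def)
  qed
  have l_lim: "filterlim l at_top at_top" unfolding l_def by real_asymp
  have budget_lim_real: "filterlim (\<lambda>G. real (prime_budget G)) at_top at_top"
    using K_bounds(1) by (intro filterlim_at_top_mono[OF l_lim] always_eventually) blast
  have budget_lim: "filterlim prime_budget at_top at_top"
    using budget_lim_real by (simp add: filterlim_sequentially_iff_filterlim_real)
  have "(\<lambda>G. ln (real (primorial (prime_budget G)))) \<sim>[at_top]
      (\<lambda>G. real (prime_budget G) * ln (real (prime_budget G)))"
    by (rule asymp_equiv_compose'[OF ln_primorial_asymp_equiv budget_lim])
  also have "(\<lambda>G. real (prime_budget G) * ln (real (prime_budget G))) \<sim>[at_top]
      (\<lambda>G. 1 / ln 2 * main_term G)"
  proof (rule asymp_equiv_sandwich_real)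
    show "(\<lambda>G. l G * ln (l G)) \<sim>[at_top] (\<lambda>G. 1 / ln 2 * main_term G)"
    proof -
      \<comment> \<open>Up to the factor \<open>1 / c\<close>, with \<open>c = ln 2\<close>, this is \<open>l G * ln (l G)\<close>; likewise for \<open>h\<close> below.\<close>
      have "(\<lambda>G. (real G + 1) * ln (real G + 1) * ln ((real G + 1) * (ln (real G + 1) / c)))
          \<sim>[at_top] (\<lambda>G. real G * ln (real G) * ln (real G * ln (real G)))"
        using c_pos by real_asymp
      from asymp_equiv_mult[OF asymp_equiv_refl[of "\<lambda>_. 1 / c"] this]
      show ?thesis by (simp add: l_def c_def mult_ac)
    qed
    show "(\<lambda>G. h G * ln (h G)) \<sim>[at_top] (\<lambda>G. 1 / ln 2 * main_term G)"
    proof -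
      have "(\<lambda>G. (real G + 1) * (ln (real G + 1) + c) * ln ((real G + 1) * (ln (real G + 1) / c + 1)))
          \<sim>[at_top] (\<lambda>G. real G * ln (real G) * ln (real G * ln (real G)))"
        using c_pos by real_asymp
      from asymp_equiv_mult[OF asymp_equiv_refl[of "\<lambda>_. 1 / c"] this]
      have "(\<lambda>G. 1 / c * ((real G + 1) * (ln (real G + 1) + c) * ln (h G)))
          \<sim>[at_top] (\<lambda>G. 1 / ln 2 * main_term G)" by (simp only: h_def c_def)
      moreover have "1 / c * ((real G + 1) * (ln (real G + 1) + c) * ln (h G)) = h G * ln (h G)" for G
        by (simp add: h_def c_def divide_simps mult.assoc)
      ultimately show ?thesis by (simp only:)
    qed
    have "\<forall>\<^sub>F G in at_top. l G \<ge> 1" using l_lim by (simp add: filterlim_at_top)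
    then show "\<forall>\<^sub>F G in at_top. real (prime_budget G) * ln (real (prime_budget G))
        \<in> {l G * ln (l G)..h G * ln (h G)}"
    proof eventually_elim
      case (elim G)
      then show ?case using K_bounds[of G] by (auto intro!: mult_mono)
    qed
  qed
  finally show ?thesis .
qed

section \<open>Consequences for the reach of an orbit\<close>

lemma main_term_pos:
  assumes "G \<ge> 2"
  shows "main_term G > 0"
proof -
  \<comment> \<open>The tight case is \<open>G = 2\<close>, where \<open>2 * ln 2 > 1\<close> is what makes the last factor positive.\<close>
  have ln2: "ln (2::real) > 1 / 2"
  proof -
    have "exp (1::real) < 4" using exp_le by linarith
    then have "ln (exp (1::real)) < ln (2 ^ 2)" by (subst ln_less_cancel_iff) auto
    then have "1 < 2 * ln (2::real)" by (simp add: ln_realpow[of 2 2, simplified])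
    then show ?thesis by simp
  qed
  have "ln 2 \<le> ln (real G)" using assms by simp
  then have "real G * ln (real G) \<ge> 2 * ln 2" using assms ln2 by (intro mult_mono) auto
  then have "real G * ln (real G) > 1" using ln2 by linarith
  then show ?thesis using assms by (intro mult_pos_pos ln_gt_zero) auto
qed

text \<open>The logarithm of the distance above \<open>n\<close> within which the orbit is guaranteed to meet a value with
  more than \<open>G\<close> divisors.\<close>

definition log_reach :: "nat \<Rightarrow> real" where
  "log_reach G = ln (real (primorial (prime_budget G) + G + 1))"

text \<open>The summand \<open>G + 1\<close> adds at most \<open>ln (G + 2)\<close> to the logarithm of the primorial, because
  \<open>P + G + 1 \<le> P * (G + 2)\<close> for \<open>P \<ge> 1\<close>.\<close>

lemma log_reach_asymp_equiv: "log_reach \<sim>[at_top] (\<lambda>G. 1 / ln 2 * main_term G)"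
proof (rule asymp_equiv_sandwich_real)
  let ?P = "\<lambda>G. real (primorial (prime_budget G))"
  show "(\<lambda>G. ln (?P G)) \<sim>[at_top] (\<lambda>G. 1 / ln 2 * main_term G)"
    by (rule ln_primorial_prime_budget_asymp_equiv)
  have "(\<lambda>G. ln (real G + 2)) \<in> o(\<lambda>G. 1 / ln 2 * main_term G)"
    by real_asymp
  then show "(\<lambda>G. ln (?P G) + ln (real G + 2)) \<sim>[at_top] (\<lambda>G. 1 / ln 2 * main_term G)"
    using ln_primorial_prime_budget_asymp_equiv by (simp only: asymp_equiv_add_right)
  have "log_reach G \<in> {ln (?P G)..ln (?P G) + ln (real G + 2)}" for G
  proof -
    have P: "?P G \<ge> 1" using primorial_pos[of "prime_budget G"] by linarith
    have "1 * (real G + 1) \<le> ?P G * (real G + 1)" using P by (intro mult_right_mono) auto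
    then have "?P G + real G + 1 \<le> ?P G * (real G + 2)" by (simp add: algebra_simps)
    then have "ln (?P G + real G + 1) \<le> ln (?P G * (real G + 2))"
      using P by (subst ln_le_cancel_iff) auto
    also have "\<dots> = ln (?P G) + ln (real G + 2)" using P by (simp add: ln_mult)
    finally show ?thesis using P by (simp add: log_reach_def ac_simps)
  qed
  then show "\<forall>\<^sub>F G in at_top. log_reach G \<in> {ln (?P G)..ln (?P G) + ln (real G + 2)}" by simp
qed

lemma exp_log_reach: "exp (log_reach G) = real (primorial (prime_budget G) + G + 1)"
  by (simp add: log_reach_def)

text \<open>The quotient of the two sides converges, hence is bounded; this covers the finitely many small
  \<open>G\<close> as well, because the main term is positive from \<open>G = 2\<close> on.\<close>

lemma log_reach_bound:
  "\<exists>C>0. \<forall>G\<ge>2. log_reach G \<le> C * main_term G"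
proof -
  have "eventually (\<lambda>G. main_term G \<noteq> 0) at_top"
    using eventually_ge_at_top[of 2]
  proof eventually_elim
    case (elim G)
    then show ?case using main_term_pos[of G] by linarith
  qed
  then have "((\<lambda>G. log_reach G / (1 / ln 2 * main_term G)) \<longlongrightarrow> 1) at_top"
    by (intro asymp_equivD_strong[OF log_reach_asymp_equiv]) (auto elim: eventually_mono)
  then have "Bseq (\<lambda>G. log_reach G / (1 / ln 2 * main_term G))"
    by (intro convergent_imp_Bseq convergentI)
  then obtain B where B: "B > 0" "\<And>G. norm (log_reach G / (1 / ln 2 * main_term G)) \<le> B"
    by (auto simp: Bseq_def)
  have "log_reach G \<le> B / ln 2 * main_term G" if "G \<ge> 2" for G
  proof -
    have m: "1 / ln 2 * main_term G > 0" using main_term_pos[OF that] by (intro mult_pos_pos[OF _ main_term_pos[OF that]]) simp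
    have "log_reach G / (1 / ln 2 * main_term G) \<le> B"
      using B(2)[of G] unfolding real_norm_def by linarith
    then have "log_reach G \<le> B * (1 / ln 2 * main_term G)"
      using m by (simp only: pos_divide_le_eq)
    then show ?thesis by simp
  qed
  then show ?thesis using B(1) by (intro exI[of _ "B / ln 2"]) auto
qed

lemma reach_le_exp:
  "\<exists>C::real. C > 0 \<and> (\<forall>n\<ge>1. \<forall>G\<ge>2. \<forall>t.
      (tau_step ^^ t) n \<le> n + primorial (prime_budget G) + G + 1 \<and>
      divisor_tau ((tau_step ^^ t) n) > G \<longrightarrow>
      real ((tau_step ^^ t) n)
        \<le> real n + exp (C * real G * ln (real G) * ln (real G * ln (real G))))"
proof -
  obtain C where C: "C > 0" "\<And>G. G \<ge> 2 \<Longrightarrow> log_reach G \<le> C * main_term G"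
    using log_reach_bound by blast
  have "real x \<le> real n + exp (C * real G * ln (real G) * ln (real G * ln (real G)))"
    if "G \<ge> 2" "x \<le> n + primorial (prime_budget G) + G + 1" for n G x :: nat
  proof -
    have "real x \<le> real n + exp (log_reach G)"
      using that(2) unfolding exp_log_reach by linarith
    also have "exp (log_reach G) \<le> exp (C * main_term G)" using C(2) that(1) by simp
    finally show ?thesis by (simp only: mult.assoc)
  qed
  then show ?thesis using C(1) by blast
qed

lemma ln_primorial_prime_budget_expansion:
  "\<exists>\<epsilon> :: nat \<Rightarrow> real. (\<epsilon> \<longlongrightarrow> 0) at_top \<and>
      (\<forall>\<^sub>F G in at_top. ln (real (primorial (prime_budget G)))
        = (1 / ln 2 + \<epsilon> G) * real G * ln (real G) * ln (real G * ln (real G)))"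
proof -
  define f where "f G = ln (real (primorial (prime_budget G)))" for G
  define \<epsilon> where "\<epsilon> G = f G / main_term G - 1 / ln 2" for G
  have nz: "eventually (\<lambda>G. main_term G \<noteq> 0) at_top"
    using eventually_ge_at_top[of 2]
  proof eventually_elim
    case (elim G)
    then show ?case using main_term_pos[of G] by linarith
  qed
  have "((\<lambda>G. f G / (1 / ln 2 * main_term G)) \<longlongrightarrow> 1) at_top"
    unfolding f_def using nz
    by (intro asymp_equivD_strong[OF ln_primorial_prime_budget_asymp_equiv]) (auto elim: eventually_mono)
  then have "((\<lambda>G. 1 / ln 2 * (f G / (1 / ln 2 * main_term G)) - 1 / ln 2) \<longlongrightarrow> 1 / ln 2 * 1 - 1 / ln 2) at_top"
    by (intro tendsto_intros)
  then have "(\<epsilon> \<longlongrightarrow> 0) at_top" by (simp add: \<epsilon>_def[abs_def])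
  moreover have "\<forall>\<^sub>F G in at_top. f G
        = (1 / ln 2 + \<epsilon> G) * real G * ln (real G) * ln (real G * ln (real G))"
    using nz
  proof eventually_elim
    case (elim G)
    then have "f G = (1 / ln 2 + \<epsilon> G) * main_term G" by (simp add: \<epsilon>_def)
    then show ?case by (simp only: mult.assoc)
  qed
  ultimately show ?thesis unfolding f_def by blast
qed

definition max_tau_within :: "nat \<Rightarrow> real \<Rightarrow> nat" where
  "max_tau_within n Y =
    Max {divisor_tau ((tau_step ^^ t) n) |t. real ((tau_step ^^ t) n) \<le> real n + Y}"

text \<open>The orbit increases strictly, so only finitely many iterates stay below \<open>n + Y\<close> and the maximum is
  taken over a finite set.\<close>

lemma divisor_tau_le_max_tau_within:
  assumes "n \<ge> 1" and "real ((tau_step ^^ t) n) \<le> real n + Y"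
  shows "divisor_tau ((tau_step ^^ t) n) \<le> max_tau_within n Y"
  unfolding max_tau_within_def
proof (rule Max_ge)
  have "{divisor_tau ((tau_step ^^ t) n) |t. real ((tau_step ^^ t) n) \<le> real n + Y}
    \<subseteq> (\<lambda>t. divisor_tau ((tau_step ^^ t) n)) ` {..nat \<lfloor>Y\<rfloor>}"
  proof clarify
    fix t assume "real ((tau_step ^^ t) n) \<le> real n + Y"
    moreover have "real n + real t \<le> real ((tau_step ^^ t) n)"
      using tau_step_iterate_ge[OF assms(1), of t] by linarith
    ultimately have "real t \<le> Y" by linarith
    then have "t \<in> {..nat \<lfloor>Y\<rfloor>}" by (simp add: le_nat_floor)
    then show "divisor_tau ((tau_step ^^ t) n) \<in> (\<lambda>t. divisor_tau ((tau_step ^^ t) n)) ` {..nat \<lfloor>Y\<rfloor>}"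
      by (rule imageI)
  qed
  then show "finite {divisor_tau ((tau_step ^^ t) n) |t. real ((tau_step ^^ t) n) \<le> real n + Y}"
    by (rule finite_subset) simp
qed (use assms(2) in blast)

lemma max_tau_within_gt:
  assumes "n \<ge> 1" and "exp (log_reach G) \<le> Y"
  shows "max_tau_within n Y > G"
proof -
  obtain t where t: "(tau_step ^^ t) n \<le> n + primorial (prime_budget G) + G + 1"
    "divisor_tau ((tau_step ^^ t) n) > G"
    using large_divisor_count_on_orbit[OF assms(1)] by blast
  have "real ((tau_step ^^ t) n) \<le> real n + Y"
    using t(1) assms(2) unfolding exp_log_reach by linarith
  then show ?thesis using divisor_tau_le_max_tau_within[OF assms(1)] t(2) by fastforce
qed

text \<open>Put \<open>a = ln 2 - \<delta>\<close>, \<open>L = ln Y\<close> and \<open>G = \<lfloor>a * L / (ln L)\<^sup>2\<rfloor>\<close>. The logarithm of the reach of \<open>G\<close>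
  is asymptotic to \<open>G * (ln G)\<^sup>2 / ln 2\<close>, so eventually at most \<open>G * (ln G)\<^sup>2 / a\<close>, where the gap
  between \<open>a\<close> and \<open>ln 2\<close> absorbs the error. As \<open>ln G \<le> ln L\<close>, this is at most \<open>L\<close>. The rounding
  is harmless because the orbit attains at least \<open>G + 1\<close>, not just \<open>G\<close>.\<close>

lemma max_tau_within_ge:
  assumes n: "n \<ge> 1" and \<delta>: "0 < \<delta>" "\<delta> < ln 2"
  shows "\<forall>\<^sub>F Y in at_top. (ln 2 - \<delta>) * (ln Y / (ln (ln Y))\<^sup>2) \<le> real (max_tau_within n Y)"
proof -
  define a where "a = ln 2 - \<delta>"
  have a: "0 < a" "a < ln 2" using \<delta> by (simp_all add: a_def)
  have ln2: "ln 2 < (1::real)" using ln_add_one_self_less_self[of 1] by simp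
  have "log_reach \<sim>[at_top] (\<lambda>G. 1 / ln 2 * (real G * (ln (real G))\<^sup>2))"
  proof (rule asymp_equiv_trans[OF log_reach_asymp_equiv])
    show "(\<lambda>G. 1 / ln 2 * main_term G) \<sim>[at_top] (\<lambda>G. 1 / ln 2 * (real G * (ln (real G))\<^sup>2))"
      by real_asymp
  qed
  from asymp_equiv_imp_eventually_le[OF this, of "ln 2 / a"]
  have "\<forall>\<^sub>F G in at_top. norm (log_reach G)
      \<le> ln 2 / a * norm (1 / ln 2 * (real G * (ln (real G))\<^sup>2))"
    using a by simp
  then have bound: "\<forall>\<^sub>F G in at_top. log_reach G \<le> real G * (ln (real G))\<^sup>2 / a \<and> G \<ge> 1"
    using eventually_ge_at_top[of 1]
  proof eventually_elim
    case (elim G)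
    have "norm (1 / ln 2 * (real G * (ln (real G))\<^sup>2)) = 1 / ln 2 * (real G * (ln (real G))\<^sup>2)"
      unfolding real_norm_def by (intro abs_of_nonneg mult_nonneg_nonneg) auto
    then show ?case using elim by simp
  qed
  define g where "g Y = a * (ln Y / (ln (ln Y))\<^sup>2)" for Y :: real
  have g_lim: "filterlim g at_top at_top" unfolding g_def using a by real_asymp
  have "filterlim (\<lambda>Y. nat \<lfloor>g Y\<rfloor>) at_top at_top"
    by (intro filterlim_compose[OF filterlim_nat_sequentially] filterlim_compose[OF filterlim_floor_sequentially] g_lim)
  from eventually_compose_filterlim[OF bound this]
  have ev1: "\<forall>\<^sub>F Y in at_top. log_reach (nat \<lfloor>g Y\<rfloor>)
      \<le> real (nat \<lfloor>g Y\<rfloor>) * (ln (real (nat \<lfloor>g Y\<rfloor>)))\<^sup>2 / a \<and> nat \<lfloor>g Y\<rfloor> \<ge> 1" .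
  have ev2: "\<forall>\<^sub>F Y in at_top. ln (ln Y) \<ge> (1::real)" by real_asymp
  from ev1 ev2 eventually_gt_at_top[of 1] show ?thesis
  proof eventually_elim
    case (elim Y)
    define L where "L = ln Y"
    define G where "G = nat \<lfloor>g Y\<rfloor>"
    have L: "L > 0" "ln L \<ge> 1" using elim by (simp_all add: L_def)
    have G: "G \<ge> 1" "log_reach G \<le> real G * (ln (real G))\<^sup>2 / a"
      using elim by (simp_all add: G_def)
    have gY: "g Y = a * L / (ln L)\<^sup>2" by (simp add: g_def L_def)
    have "g Y \<ge> 0" using a L unfolding gY by simp
    then have G_le: "real G \<le> a * L / (ln L)\<^sup>2" and G_gt: "real G + 1 > g Y"
      unfolding G_def gY[symmetric] by linarith+
    have sq: "(ln L)\<^sup>2 \<ge> 1" using L by simp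
    have "a * L / (ln L)\<^sup>2 \<le> a * L / 1" using sq a L by (intro divide_left_mono) auto
    also have "\<dots> \<le> 1 * L" using a ln2 L by simp
    finally have "real G \<le> L" using G_le by simp
    then have "ln (real G) \<le> ln L" using G(1) by simp
    then have "(ln (real G))\<^sup>2 \<le> (ln L)\<^sup>2" using G(1) by (intro power_mono) auto
    then have "real G * (ln (real G))\<^sup>2 \<le> (a * L / (ln L)\<^sup>2) * (ln L)\<^sup>2"
      using G_le by (intro mult_mono) auto
    also have "\<dots> = a * L" using L(2) by (cases "ln L = 0") auto
    finally have "real G * (ln (real G))\<^sup>2 / a \<le> L" using a by (simp add: field_simps)
    then have "log_reach G \<le> ln Y" using G(2) by (simp add: L_def)
    then have "exp (log_reach G) \<le> exp (ln Y)" by simp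
    then have "exp (log_reach G) \<le> Y" using elim by simp
    then have "real G + 1 \<le> real (max_tau_within n Y)"
      using max_tau_within_gt[OF n, of G Y] by linarith
    then show ?case using G_gt unfolding g_def a_def by linarith
  qed
qed

text \<open>As \<open>\<epsilon> Y\<close> serves the positive part of the deficit from \<open>ln 2\<close>: then it tends to \<open>0\<close> even
  if the maximum exceeds the bound by far.\<close>

lemma max_tau_within_lower_bound:
  assumes n: "n \<ge> 1"
  shows "\<exists>\<epsilon> :: real \<Rightarrow> real. (\<epsilon> \<longlongrightarrow> 0) at_top \<and>
    (\<forall>\<^sub>F Y in at_top. real (max_tau_within n Y) \<ge> (ln 2 - \<epsilon> Y) * (ln Y / (ln (ln Y))\<^sup>2))"
proof -
  define h where "h Y = ln Y / (ln (ln Y))\<^sup>2" for Y :: real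
  define \<epsilon> where "\<epsilon> Y = max 0 (ln 2 - real (max_tau_within n Y) / h Y)" for Y
  have h_pos: "\<forall>\<^sub>F Y in at_top. h Y > 0" unfolding h_def by real_asymp
  have "(\<epsilon> \<longlongrightarrow> 0) at_top"
  proof (rule order_tendstoI)
    fix e :: real assume "e < 0"
    then have "e < \<epsilon> Y" for Y by (simp add: \<epsilon>_def less_max_iff_disj)
    then show "\<forall>\<^sub>F Y in at_top. e < \<epsilon> Y" by simp
  next
    fix e :: real assume "e > 0"
    define \<delta> where "\<delta> = min (e / 2) (ln 2 / 2)"
    have \<delta>: "0 < \<delta>" "\<delta> < ln 2" "\<delta> < e" using \<open>e > 0\<close> by (auto simp: \<delta>_def min_def)
    show "\<forall>\<^sub>F Y in at_top. \<epsilon> Y < e"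
      using max_tau_within_ge[OF n \<delta>(1,2)] h_pos
    proof eventually_elim
      case (elim Y)
      then have "ln 2 - \<delta> \<le> real (max_tau_within n Y) / h Y"
        unfolding h_def[symmetric] by (simp add: pos_le_divide_eq)
      then show ?case using \<delta> \<open>e > 0\<close> by (simp add: \<epsilon>_def)
    qed
  qed
  moreover have "\<forall>\<^sub>F Y in at_top. real (max_tau_within n Y) \<ge> (ln 2 - \<epsilon> Y) * h Y"
    using h_pos
  proof eventually_elim
    case (elim Y)
    have "ln 2 - \<epsilon> Y \<le> real (max_tau_within n Y) / h Y" by (simp add: \<epsilon>_def)
    then show ?case using elim by (simp add: pos_le_divide_eq)
  qed
  ultimately show ?thesis unfolding h_def by blast
qed

text \<open>Applied to the orbit of a late iterate, the existence result yields arbitrarily late values above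
  any \<open>G\<close>.\<close>

lemma limsup_divisor_tau_orbit:
  assumes n: "n \<ge> 1"
  shows "limsup (\<lambda>t. ereal (real (divisor_tau ((tau_step ^^ t) n)))) = \<infinity>"
proof -
  have "ereal (real G) \<le> limsup (\<lambda>t. ereal (real (divisor_tau ((tau_step ^^ t) n))))" for G
  proof -
    have "\<exists>t\<ge>s. divisor_tau ((tau_step ^^ t) n) > G" for s
    proof -
      have "(tau_step ^^ s) n \<ge> 1" using tau_step_iterate_ge[OF n, of s] n by linarith
      from large_divisor_count_on_orbit[OF this, of G] obtain t
        where "divisor_tau ((tau_step ^^ t) ((tau_step ^^ s) n)) > G" by blast
      then show ?thesis by (intro exI[of _ "t + s"]) (simp add: funpow_add)
    qed
    then show ?thesis
      unfolding limsup_INF_SUP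
      by (intro INF_greatest) (metis atLeast_iff ereal_less_eq(3) less_imp_le of_nat_le_iff SUP_upper2)
  qed
  then show ?thesis
    by (intro ereal_top) (meson ereal_less_eq(3) order_trans real_arch_simple)
qed

theorem theorem10p3:
  "(\<forall>n\<ge>1. \<forall>G\<ge>2. \<exists>t.
      (tau_step ^^ t) n \<le> n + primorial (prime_budget G) + G + 1 \<and>
      divisor_tau ((tau_step ^^ t) n) > G)
   \<and> (\<exists>C::real. C > 0 \<and> (\<forall>n\<ge>1. \<forall>G\<ge>2. \<forall>t.
      (tau_step ^^ t) n \<le> n + primorial (prime_budget G) + G + 1 \<and>
      divisor_tau ((tau_step ^^ t) n) > G \<longrightarrow>
      real ((tau_step ^^ t) n)
        \<le> real n + exp (C * real G * ln (real G) * ln (real G * ln (real G)))))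
   \<and> (\<exists>\<epsilon> :: nat \<Rightarrow> real. (\<epsilon> \<longlongrightarrow> 0) at_top \<and>
      (\<forall>\<^sub>F G in at_top. ln (real (primorial (prime_budget G)))
        = (1 / ln 2 + \<epsilon> G) * real G * ln (real G) * ln (real G * ln (real G))))
   \<and> (\<forall>n\<ge>1. \<exists>\<epsilon> :: real \<Rightarrow> real. (\<epsilon> \<longlongrightarrow> 0) at_top \<and>
      (\<forall>\<^sub>F Y in at_top.
        real (Max {divisor_tau ((tau_step ^^ t) n) |t. real ((tau_step ^^ t) n) \<le> real n + Y})
          \<ge> (ln 2 - \<epsilon> Y) * (ln Y / (ln (ln Y))^2)))
   \<and> (\<forall>n\<ge>1. limsup (\<lambda>t. ereal (real (divisor_tau ((tau_step ^^ t) n)))) = \<infinity>)"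
  using large_divisor_count_on_orbit reach_le_exp ln_primorial_prime_budget_expansion
    max_tau_within_lower_bound[unfolded max_tau_within_def] limsup_divisor_tau_orbit
  by (intro conjI) blast+

end
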